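(* Let $\omega=e^{2\pi i/3}$ and let $\Lambda=\mathbb{Z}[\omega]\subset\mathbb{C}\cong\mathbb{R}^2$ be the hexagonal lattice generated by $1$ and $\omega$. For $\alpha=a+b\omega$ with $a,b\in\mathbb{Z}$, $\alpha\neq0$, the sublattice $\alpha\Lambda$ is clean if and only if $\alpha\theta$ is a primitive element of $\mathbb{Z}[\omega]$, where $\theta=\omega-\bar\omega=\sqrt{-3}$. Moreover, for a positive integer $c$, there is a clean sublattice of $\Lambda$ of index $c$ similar to $\Lambda$ if and only if $c$ is a product of primes $\equiv1\pmod 3$.
   Context: A sublattice $\Lambda'\subseteq\Lambda$ is clean if the boundaries of the Voronoi cells of $\Lambda'$ (in $\mathbb{R}^2$) contain no point of $\Lambda$. An element $r+s\omega\in\mathbb{Z}[\omega]$ ($r,s\in\mathbb{Z}$) is primitive if $\gcd(r,s)=1$. A sublattice similar to $\Lambda$ is one of the form $\sigma(\Lambda)\subseteq\Lambda$ for a linear map $\sigma$ with $\sigma u\cdot\sigma v=c\,u\cdot v$ for some $c>0$. *)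

theory Defs
  imports "HOL-Analysis.Analysis" "HOL-Number_Theory.Number_Theory"
begin

definition omega :: complex where
  "omega = exp (2 * of_real pi * \<i> / 3)"

definition theta :: complex where
  "theta = omega - cnj omega"

lemma theta_eq: "theta = \<i> * of_real (sqrt 3)"
proof -
  have "omega = cis (2 * pi / 3)"
    by (simp add: omega_def cis_conv_exp mult_ac)
  then show ?thesis
    by (simp add: theta_def complex_eq_iff sin_120)
qed

definition hex_lattice :: "complex set" where
  "hex_lattice = {of_int r + of_int s * omega | r s :: int. True}"

definition primitive :: "complex \<Rightarrow> bool" where
  "primitive z \<longleftrightarrow> (\<exists>r s :: int. z = of_int r + of_int s * omega \<and> gcd r s = 1)"

definition voronoi_cell :: "complex set \<Rightarrow> complex \<Rightarrow> complex set" where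
  "voronoi_cell M x = {z. \<forall>y\<in>M. dist z x \<le> dist z y}"

definition clean :: "complex set \<Rightarrow> bool" where
  "clean M \<longleftrightarrow> (\<forall>x\<in>M. frontier (voronoi_cell M x) \<inter> hex_lattice = {})"

definition similar_sublattice :: "complex set \<Rightarrow> bool" where
  "similar_sublattice M \<longleftrightarrow>
     M \<subseteq> hex_lattice \<and>
     (\<exists>\<sigma> :: complex \<Rightarrow> complex. linear \<sigma> \<and>
        (\<exists>k>0. \<forall>u v. \<sigma> u \<bullet> \<sigma> v = k * (u \<bullet> v)) \<and>
        M = \<sigma> ` hex_lattice)"

text \<open>The index of \<open>M\<close> as a subgroup: the number of cosets \<open>x + M\<close> with \<open>x\<close> in the
  lattice. It is \<open>0\<close> when there are infinitely many of them.\<close>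

definition sublattice_index :: "complex set \<Rightarrow> nat" where
  "sublattice_index M = card ((\<lambda>x. (+) x ` M) ` hex_lattice)"

end

theory Submission
  imports Defs
begin

text \<open>Write \<open>\<alpha> = a + b \<omega>\<close> and \<open>N = |\<alpha>|\<^sup>2\<close>. For a lattice point \<open>z\<close>, the numbers
  \<open>2 Re (z cnj (\<alpha> u))\<close> with \<open>u\<close> one of the six units are integers, and \<open>z\<close> lies on the boundary
  of the Voronoi cell of \<open>0\<close> iff their maximum is \<open>N\<close>. If \<open>\<alpha> \<theta>\<close> is primitive, then the lattice
  points \<open>z\<close> with \<open>2 Re (z cnj \<alpha>) = N\<close> all satisfy \<open>2 z = \<alpha> (1 + k \<theta>)\<close> with an integer \<open>k\<close>;
  on the edge of the cell this forces \<open>k = 0\<close>, which contradicts primitivity. If \<open>\<alpha> \<theta>\<close> is not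
  primitive, explicit boundary points exist.

  Every similar sublattice is of the form \<open>\<alpha> \<Lambda>\<close>, and if \<open>\<alpha>\<close> is primitive its index is \<open>N\<close>, because
  \<open>p + q \<omega> \<mapsto> q a - p b\<close> induces an isomorphism from \<open>\<Lambda> / \<alpha> \<Lambda>\<close> to the integers modulo \<open>N\<close>. It remains
  to see that the norms of \<open>\<alpha>\<close> with \<open>\<alpha> \<theta>\<close> primitive are the products of primes \<open>p \<equiv> 1\<close> modulo 3:
  such a \<open>p\<close> is a norm by descent, and \<open>\<alpha>\<close> stays primitive after multiplication by an element of
  norm \<open>p\<close> or by its conjugate.\<close>

section \<open>Lattice points and their norms\<close>

definition hex :: "int \<Rightarrow> int \<Rightarrow> complex" where
  "hex r s = of_int r + of_int s * omega"

definition hexnorm :: "int \<Rightarrow> int \<Rightarrow> int" where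
  "hexnorm r s = r\<^sup>2 - r * s + s\<^sup>2"

text \<open>For z = p + q omega and alpha = a + b omega this is 2 Re (z cnj alpha), the bilinear
  form polar to \<open>hexnorm\<close>.\<close>

definition hextrace :: "int \<Rightarrow> int \<Rightarrow> int \<Rightarrow> int \<Rightarrow> int" where
  "hextrace a b p q = p * (2 * a - b) + q * (2 * b - a)"

lemma omega_Complex: "omega = Complex (- 1 / 2) (sqrt 3 / 2)"
proof -
  have "omega = cis (2 * pi / 3)"
    by (simp add: omega_def cis_conv_exp mult_ac)
  then show ?thesis
    by (simp add: complex_eq_iff sin_120 cos_120)
qed

lemma omega_sq: "omega * omega = - 1 - omega"
  by (simp add: omega_Complex complex_eq_iff)

lemma theta_hex: "theta = hex 1 2"
  by (simp add: theta_def hex_def omega_Complex complex_eq_iff)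

lemma hex_inject: "hex r s = hex r' s' \<longleftrightarrow> r = r' \<and> s = s'"
  by (auto simp: hex_def omega_Complex complex_eq_iff)

lemma hex_eq_0_iff: "hex r s = 0 \<longleftrightarrow> r = 0 \<and> s = 0"
  by (auto simp: hex_def omega_Complex complex_eq_iff)

lemma hex_lattice_eq: "hex_lattice = range (\<lambda>(r, s). hex r s)"
  by (auto simp: hex_lattice_def hex_def)

lemma hex_in [simp, intro]: "hex r s \<in> hex_lattice"
  by (auto simp: hex_lattice_eq)

lemma hex_latticeE:
  assumes "z \<in> hex_lattice" obtains r s where "z = hex r s"
  using assms by (auto simp: hex_lattice_eq)

lemma hex_add: "hex a b + hex e f = hex (a + e) (b + f)"
  by (simp add: hex_def algebra_simps)

lemma hex_diff: "hex a b - hex e f = hex (a - e) (b - f)"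
  by (simp add: hex_def algebra_simps)

lemma hex_mult: "hex a b * hex e f = hex (a * e - b * f) (a * f + b * e - b * f)"
proof -
  have "hex a b * hex e f =
      of_int (a * e) + of_int (a * f + b * e) * omega + of_int (b * f) * (omega * omega)"
    by (simp add: hex_def algebra_simps)
  also have "\<dots> = hex (a * e - b * f) (a * f + b * e - b * f)"
    unfolding omega_sq by (simp add: hex_def algebra_simps)
  finally show ?thesis .
qed

lemma norm_hex: "(norm (hex r s))\<^sup>2 = of_int (hexnorm r s)"
  unfolding cmod_power2
  by (simp add: hex_def omega_Complex hexnorm_def power2_eq_square field_simps)

lemma hexnorm_mult:
  "hexnorm (a * e - b * f) (a * f + b * e - b * f) = hexnorm a b * hexnorm e f"
  by (simp add: hexnorm_def power2_eq_square algebra_simps)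

lemma four_hexnorm: "4 * hexnorm r s = (2 * r - s)\<^sup>2 + 3 * s\<^sup>2"
  by (simp add: hexnorm_def power2_eq_square algebra_simps)

lemma hexnorm_nonneg: "hexnorm r s \<ge> 0"
  using four_hexnorm[of r s] by (smt (verit) zero_le_power2)

lemma hexnorm_pos_iff: "hexnorm r s > 0 \<longleftrightarrow> r \<noteq> 0 \<or> s \<noteq> 0"
proof -
  have "hexnorm r s = 0 \<longleftrightarrow> hex r s = 0"
    using norm_hex[of r s] by (metis norm_eq_zero of_int_eq_0_iff zero_eq_power2)
  then show ?thesis
    using hexnorm_nonneg[of r s] by (auto simp: hex_eq_0_iff)
qed

text \<open>Expansion of |z - alpha beta|^2 for beta = r + s omega. The pair \<open>- b\<close>,
  \<open>a - b\<close> gives the coordinates of alpha omega, so the two traces pair z with the basis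
  alpha, alpha omega of the sublattice.\<close>

lemma hexnorm_diff_mult:
  "hexnorm (p - (a * r - b * s)) (q - (a * s + b * r - b * s)) =
     hexnorm p q - (hextrace a b p q * r + hextrace (- b) (a - b) p q * s)
       + hexnorm a b * hexnorm r s"
  by (simp add: hexnorm_def hextrace_def power2_eq_square algebra_simps)

lemma hex_norm_le_iff: "norm (hex p q) \<le> norm (hex r s) \<longleftrightarrow> hexnorm p q \<le> hexnorm r s"
  by (metis norm_hex norm_ge_zero of_int_le_iff power_mono power2_le_imp_le)

lemma hex_norm_eq_iff: "norm (hex p q) = norm (hex r s) \<longleftrightarrow> hexnorm p q = hexnorm r s"
  using hex_norm_le_iff[of p q r s] hex_norm_le_iff[of r s p q] by linarith

section \<open>Voronoi cells\<close>

lemma closed_voronoi_cell: "closed (voronoi_cell M x)"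
proof -
  have "voronoi_cell M x = (\<Inter>y\<in>M. {z. dist z x \<le> dist z y})"
    by (auto simp: voronoi_cell_def)
  moreover have "closed {z. dist z x \<le> dist z y}" for y :: complex
    by (intro closed_Collect_le continuous_intros)
  ultimately show ?thesis by auto
qed

text \<open>Moving z towards a tied centre y leaves the cell. Without ties, all other centres are
  farther away by a uniform margin, so a small ball around z stays inside the cell.\<close>

lemma frontier_voronoi_cell_iff:
  assumes M: "M \<subseteq> hex_lattice" and x: "x \<in> M" and z: "z \<in> hex_lattice"
  shows "z \<in> frontier (voronoi_cell M x) \<longleftrightarrow>
    z \<in> voronoi_cell M x \<and> (\<exists>y\<in>M. y \<noteq> x \<and> dist z x = dist z y)"
proof -
  have fr: "z \<in> frontier (voronoi_cell M x) \<longleftrightarrow>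
      z \<in> voronoi_cell M x \<and> z \<notin> interior (voronoi_cell M x)"
    by (simp add: frontier_def closure_closed closed_voronoi_cell)
  have "z \<notin> interior (voronoi_cell M x)"
    if y: "y \<in> M" "y \<noteq> x" "dist z x = dist z y" for y
  proof
    assume "z \<in> interior (voronoi_cell M x)"
    then obtain e where e: "e > 0" "ball z e \<subseteq> voronoi_cell M x"
      by (auto simp: mem_interior)
    define d where "d = y - x"
    define u where "u = z - x"
    have d: "norm d > 0" using y by (simp add: d_def)
    define t where "t = e / (2 * norm d)"
    have t: "t > 0" using e d by (simp add: t_def)
    have "dist z (z + t *\<^sub>R d) < e"
      using e d by (simp add: dist_norm t_def)
    with e have "z + t *\<^sub>R d \<in> voronoi_cell M x" by auto
    then have "norm (u + t *\<^sub>R d) \<le> norm (u + (t - 1) *\<^sub>R d)"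
      using y by (auto simp: voronoi_cell_def dist_norm u_def d_def algebra_simps)
    then have "(norm (u + t *\<^sub>R d))\<^sup>2 \<le> (norm (u + (t - 1) *\<^sub>R d))\<^sup>2"
      by (simp add: power_mono)
    then have 1: "2 * t * (u \<bullet> d) + t\<^sup>2 * (d \<bullet> d) \<le> 2 * (t - 1) * (u \<bullet> d) + (t - 1)\<^sup>2 * (d \<bullet> d)"
      unfolding power2_norm_eq_inner
      by (simp add: inner_add inner_commute[of d u] power2_eq_square algebra_simps)
    have "norm u = norm (u - d)"
      using y by (simp add: dist_norm u_def d_def)
    then have "u \<bullet> u = (u - d) \<bullet> (u - d)"
      by (metis power2_norm_eq_inner)
    then have "2 * (u \<bullet> d) = d \<bullet> d"
      by (simp add: inner_diff inner_commute[of d u])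
    with 1 have "t * (d \<bullet> d) \<le> 0"
      by (simp add: power2_eq_square algebra_simps)
    moreover have "d \<bullet> d > 0" using d by auto
    ultimately show False using t by (simp add: mult_le_0_iff)
  qed
  moreover have "z \<in> interior (voronoi_cell M x)"
    if cell: "z \<in> voronoi_cell M x" and ne: "\<And>y. y \<in> M \<Longrightarrow> y \<noteq> x \<Longrightarrow> dist z x \<noteq> dist z y"
  proof -
    define d where "d = dist z x"
    \<comment> \<open>Every other centre will be farther from z by at least 2 e; a move by less than
      e changes each distance by less than e, so x stays the nearest centre.\<close>
    define e where "e = (sqrt (d\<^sup>2 + 1) - d) / 2"
    have "sqrt (d\<^sup>2 + 1) > d" by (rule real_less_rsqrt) simp
    then have e: "e > 0" by (simp add: e_def)
    \<comment> \<open>Squared distances between lattice points are integers, so a strict inequality has a gap.\<close>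
    have gap: "dist z y \<ge> d + 2 * e" if y: "y \<in> M" "y \<noteq> x" for y
    proof -
      have "dist z x < dist z y"
        using cell ne[OF y] y by (force simp: voronoi_cell_def)
      moreover obtain p q where "z - x = hex p q"
        using z x M by (metis hex_latticeE hex_diff subsetD)
      moreover obtain r s where "z - y = hex r s"
        using z y M by (metis hex_latticeE hex_diff subsetD)
      ultimately have "hexnorm p q < hexnorm r s" and
        eq: "d\<^sup>2 = of_int (hexnorm p q)" "(dist z y)\<^sup>2 = of_int (hexnorm r s)"
        by (auto simp: d_def dist_norm norm_hex not_le[symmetric] hex_norm_le_iff)
      then have "d\<^sup>2 + 1 \<le> (dist z y)\<^sup>2" by simp
      then have "sqrt (d\<^sup>2 + 1) \<le> dist z y" by (simp add: real_le_lsqrt)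
      then show ?thesis by (simp add: e_def field_simps)
    qed
    have "ball z e \<subseteq> voronoi_cell M x"
    proof
      fix w assume "w \<in> ball z e"
      then have w: "dist z w < e" by simp
      have "dist w x \<le> dist w y" if "y \<in> M" for y
      proof (cases "y = x")
        case False
        have "dist w x \<le> dist z w + d" using dist_triangle[of w x z] by (simp add: d_def dist_commute)
        moreover have "dist z y \<le> dist z w + dist w y" by (rule dist_triangle)
        ultimately show ?thesis using gap[OF that False] w by linarith
      qed auto
      then show "w \<in> voronoi_cell M x" by (simp add: voronoi_cell_def)
    qed
    with e show ?thesis by (auto simp: mem_interior)
  qed
  ultimately show ?thesis unfolding fr by blast
qed

text \<open>On the six units the linear form takes the values A, B, A + B up to sign. Up to sign, r
  + s omega lies in a sector spanned by two adjacent units; its coordinates i, j there satisfy i j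
  >= 0, and its norm i^2 + i j + j^2 is at least |i| + |j| by integrality.\<close>

lemma hexagon_bound:
  fixes A B K r s :: int
  assumes "\<bar>A\<bar> \<le> K" "\<bar>B\<bar> \<le> K" "\<bar>A + B\<bar> \<le> K"
  shows "\<bar>A * r + B * s\<bar> \<le> K * hexnorm r s"
proof -
  have K: "K \<ge> 0" using assms by linarith
  have sq: "\<bar>i\<bar> \<le> i * i" for i :: int
    using mult_right_mono[of 1 "\<bar>i\<bar>" "\<bar>i\<bar>"] by (cases "i = 0") auto
  have main: "\<bar>X * i + Y * j\<bar> \<le> K * (i * i + i * j + j * j)"
    if "\<bar>X\<bar> \<le> K" "\<bar>Y\<bar> \<le> K" "i * j \<ge> 0" for X Y i j :: int
  proof -
    have "\<bar>X * i + Y * j\<bar> \<le> K * \<bar>i\<bar> + K * \<bar>j\<bar>"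
      by (rule order.trans[OF abs_triangle_ineq])
        (use that in \<open>auto simp: abs_mult intro!: add_mono mult_right_mono\<close>)
    also have "\<dots> = K * (\<bar>i\<bar> + \<bar>j\<bar>)" by (simp add: algebra_simps)
    also have "\<dots> \<le> K * (i * i + i * j + j * j)"
      using sq[of i] sq[of j] that K by (intro mult_left_mono) auto
    finally show ?thesis .
  qed
  \<comment> \<open>These are the three pairs of opposite sectors, spanned by 1 and -omega, by 1 and
    1 + omega, and by omega and 1 + omega.\<close>
  consider "r * s \<le> 0" | "(r - s) * s \<ge> 0" | "(s - r) * r \<ge> 0"
  proof -
    have "r * s \<le> 0 \<or> (r - s) * s \<ge> 0 \<or> (s - r) * r \<ge> 0"
      unfolding zero_le_mult_iff mult_le_0_iff by linarith
    then show thesis using that by blast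
  qed
  then show ?thesis
  proof cases
    case 1
    then show ?thesis
      using main[of A "- B" r "- s"] assms by (simp add: hexnorm_def power2_eq_square)
  next
    case 2
    then show ?thesis
      using main[of A "A + B" "r - s" s] assms
      by (simp add: hexnorm_def power2_eq_square algebra_simps)
  next
    case 3
    then show ?thesis
      using main[of B "A + B" "s - r" r] assms
      by (simp add: hexnorm_def power2_eq_square algebra_simps)
  qed
qed

lemma mult_hex_lattice: "(*) (hex a b) ` hex_lattice = range (\<lambda>(r, s). hex a b * hex r s)"
  by (auto simp: hex_lattice_eq)

lemma mult_hex_lattice_subset: "(*) (hex a b) ` hex_lattice \<subseteq> hex_lattice"
  by (auto simp: mult_hex_lattice hex_mult)

text \<open>Translations by the sublattice permute its cells and preserve the hexagonal lattice, so
  only the cell of 0 has to be examined.\<close>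

lemma clean_mult_hex_iff_equidistant:
  "clean ((*) (hex a b) ` hex_lattice) \<longleftrightarrow>
    \<not> (\<exists>p q. (\<forall>r s. norm (hex p q) \<le> norm (hex p q - hex a b * hex r s)) \<and>
        (\<exists>r s. hex a b * hex r s \<noteq> 0 \<and> norm (hex p q) = norm (hex p q - hex a b * hex r s)))"
    (is "clean ?M \<longleftrightarrow> \<not> ?R")
proof -
  have "?R" if "\<not> clean ?M"
  proof -
    from that obtain x z where x: "x \<in> ?M" and z: "z \<in> hex_lattice"
      and fr: "z \<in> frontier (voronoi_cell ?M x)"
      unfolding clean_def by blast
    obtain y where cell: "\<And>y. y \<in> ?M \<Longrightarrow> dist z x \<le> dist z y"
      and y: "y \<in> ?M" "y \<noteq> x" "dist z x = dist z y"
      using fr[unfolded frontier_voronoi_cell_iff[OF mult_hex_lattice_subset x z]]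
      unfolding voronoi_cell_def by blast
    obtain i j where ij: "x = hex a b * hex i j" using x by (auto simp: mult_hex_lattice)
    obtain k l where kl: "y = hex a b * hex k l" using y by (auto simp: mult_hex_lattice)
    obtain p q where pq: "z - x = hex p q"
      using z x mult_hex_lattice_subset by (metis hex_latticeE hex_diff subsetD)
    have "norm (hex p q) \<le> norm (hex p q - hex a b * hex r s)" for r s
    proof -
      have "hex a b * hex (i + r) (j + s) \<in> ?M" by (intro imageI hex_in)
      from cell[OF this] show ?thesis
        by (simp add: dist_norm flip: pq hex_add) (simp add: ij algebra_simps)
    qed
    moreover have "hex a b * hex (k - i) (l - j) = y - x"
      by (simp add: ij kl algebra_simps flip: hex_diff)
    then have "hex a b * hex (k - i) (l - j) \<noteq> 0 \<and>
        norm (hex p q) = norm (hex p q - hex a b * hex (k - i) (l - j))"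
      using y by (simp add: dist_norm flip: pq)
    ultimately show ?R by blast
  qed
  moreover have "\<not> clean ?M" if ?R
  proof -
    from that obtain p q r s where
      le: "\<And>r s. norm (hex p q) \<le> norm (hex p q - hex a b * hex r s)" and
      eq: "hex a b * hex r s \<noteq> 0" "norm (hex p q) = norm (hex p q - hex a b * hex r s)"
      by blast
    have "hex a b * hex 0 0 \<in> ?M" by blast
    then have 0: "0 \<in> ?M" by (simp add: hex_def)
    have "hex p q \<in> frontier (voronoi_cell ?M 0)"
      unfolding frontier_voronoi_cell_iff[OF mult_hex_lattice_subset 0 hex_in]
      using le eq by (auto simp: voronoi_cell_def mult_hex_lattice dist_norm)
    with 0 show ?thesis unfolding clean_def by blast
  qed
  ultimately show ?thesis by blast
qed

text \<open>Only the six neighbours of the origin, whose inner products with the given point are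
  the three traces up to sign, matter for the Voronoi cell of the origin.\<close>

lemma clean_mult_hex_iff_hextrace:
  assumes "a \<noteq> 0 \<or> b \<noteq> 0"
  defines "N \<equiv> hexnorm a b"
  shows "clean ((*) (hex a b) ` hex_lattice) \<longleftrightarrow>
    \<not> (\<exists>p q. let A = hextrace a b p q; B = hextrace (- b) (a - b) p q in
        \<bar>A\<bar> \<le> N \<and> \<bar>B\<bar> \<le> N \<and> \<bar>A + B\<bar> \<le> N \<and> (\<bar>A\<bar> = N \<or> \<bar>B\<bar> = N \<or> \<bar>A + B\<bar> = N))"
proof -
  have N: "N > 0" using assms by (simp add: hexnorm_pos_iff)
  have "(\<forall>r s. norm (hex p q) \<le> norm (hex p q - hex a b * hex r s)) \<and>
      (\<exists>r s. hex a b * hex r s \<noteq> 0 \<and> norm (hex p q) = norm (hex p q - hex a b * hex r s)) \<longleftrightarrow>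
      (let A = hextrace a b p q; B = hextrace (- b) (a - b) p q in
        \<bar>A\<bar> \<le> N \<and> \<bar>B\<bar> \<le> N \<and> \<bar>A + B\<bar> \<le> N \<and> (\<bar>A\<bar> = N \<or> \<bar>B\<bar> = N \<or> \<bar>A + B\<bar> = N))"
    (is "?L \<longleftrightarrow> _") for p q
  proof -
    define A where "A = hextrace a b p q"
    define B where "B = hextrace (- b) (a - b) p q"
    have nz: "hex a b * hex r s \<noteq> 0 \<longleftrightarrow> r \<noteq> 0 \<or> s \<noteq> 0" for r s
      using assms by (auto simp: hex_eq_0_iff)
    \<comment> \<open>Once |z|^2 is cancelled, comparing distances amounts to comparing the linear
      form A r + B s with N times the norm form.\<close>
    have L: "?L \<longleftrightarrow> (\<forall>r s. A * r + B * s \<le> N * hexnorm r s) \<and>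
        (\<exists>r s. (r \<noteq> 0 \<or> s \<noteq> 0) \<and> A * r + B * s = N * hexnorm r s)"
      unfolding nz unfolding hex_mult hex_diff hex_norm_le_iff hex_norm_eq_iff hexnorm_diff_mult
        A_def B_def N_def
      by (auto simp: algebra_simps)
    have "\<bar>A\<bar> \<le> N \<and> \<bar>B\<bar> \<le> N \<and> \<bar>A + B\<bar> \<le> N \<longleftrightarrow> (\<forall>r s. A * r + B * s \<le> N * hexnorm r s)"
      (is "?X \<longleftrightarrow> ?Y")
    proof
      assume ?Y
      from this[rule_format, of 1 0] this[rule_format, of "-1" 0] this[rule_format, of 0 1]
        this[rule_format, of 0 "-1"] this[rule_format, of 1 1] this[rule_format, of "-1" "-1"]
      show ?X by (simp add: hexnorm_def abs_le_iff)
    next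
      assume ?X
      then show ?Y using hexagon_bound[of A N B] by (meson abs_le_D1)
    qed
    moreover have "\<bar>A\<bar> = N \<or> \<bar>B\<bar> = N \<or> \<bar>A + B\<bar> = N"
      if X: ?X and "r \<noteq> 0 \<or> s \<noteq> 0" "A * r + B * s = N * hexnorm r s" for r s
    proof (rule ccontr)
      assume "\<not> ?thesis"
      \<comment> \<open>By integrality \<open>hexagon_bound\<close> applies with N - 1 in place of
        N, which excludes equality at a nonzero r + s omega.\<close>
      then have "\<bar>A\<bar> \<le> N - 1" "\<bar>B\<bar> \<le> N - 1" "\<bar>A + B\<bar> \<le> N - 1" using X by auto
      then have "\<bar>A * r + B * s\<bar> \<le> (N - 1) * hexnorm r s" by (rule hexagon_bound)
      then show False
        using that hexnorm_pos_iff[of r s] by (simp add: algebra_simps)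
    qed
    moreover have "\<exists>r s. (r \<noteq> 0 \<or> s \<noteq> 0) \<and> A * r + B * s = N * hexnorm r s"
      if edge: "\<bar>A\<bar> = N \<or> \<bar>B\<bar> = N \<or> \<bar>A + B\<bar> = N"
    proof -
      consider "A = N" | "- A = N" | "B = N" | "- B = N" | "A + B = N" | "- A - B = N"
        using edge abs_if[of A] abs_if[of B] abs_if[of "A + B"] by (auto split: if_splits)
      then show ?thesis
      proof cases
        case 1 then show ?thesis by (intro exI[of _ 1] exI[of _ 0]) (simp add: hexnorm_def)
      next
        case 2 then show ?thesis by (intro exI[of _ "-1"] exI[of _ 0]) (simp add: hexnorm_def)
      next
        case 3 then show ?thesis by (intro exI[of _ 0] exI[of _ 1]) (simp add: hexnorm_def)
      next
        case 4 then show ?thesis by (intro exI[of _ 0] exI[of _ "-1"]) (simp add: hexnorm_def)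
      next
        case 5 then show ?thesis by (intro exI[of _ 1] exI[of _ 1]) (simp add: hexnorm_def)
      next
        case 6 then show ?thesis by (intro exI[of _ "-1"] exI[of _ "-1"]) (simp add: hexnorm_def)
      qed
    qed
    ultimately have "?L \<longleftrightarrow> ?X \<and> (\<bar>A\<bar> = N \<or> \<bar>B\<bar> = N \<or> \<bar>A + B\<bar> = N)"
      unfolding L by metis
    then show ?thesis
      by (simp add: A_def B_def Let_def conj_assoc)
  qed
  then show ?thesis unfolding clean_mult_hex_iff_equidistant by presburger
qed

section \<open>Clean sublattices and primitivity\<close>

text \<open>The arguments of the gcd are the coordinates of alpha theta. Multiplication by theta has
  determinant 3, so a common prime divisor of them divides 3 a and 3 b, hence is 3 or divides both a
  and b. Modulo 3 the norm is (a + b)^2.\<close>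

lemma coprime_hexnorm_iff:
  "gcd (a - 2 * b) (2 * a - b) = 1 \<longleftrightarrow> coprime a b \<and> \<not> 3 dvd hexnorm a b"
proof -
  have N: "hexnorm a b = (a + b) * (a + b) - 3 * (a * b)"
    by (simp add: hexnorm_def power2_eq_square algebra_simps)
  have "prime (3::int)" by simp
  then have three: "3 dvd hexnorm a b \<longleftrightarrow> 3 dvd a + b"
    unfolding N by (simp add: dvd_diff_left_iff prime_dvd_mult_iff)
  show ?thesis
  proof
    assume 1: "gcd (a - 2 * b) (2 * a - b) = 1"
    have "coprime a b"
    proof (rule coprimeI)
      fix d assume "d dvd a" "d dvd b"
      then have "d dvd gcd (a - 2 * b) (2 * a - b)" by simp
      with 1 show "is_unit d" by simp
    qed
    moreover have "\<not> 3 dvd a + b"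
    proof
      assume "3 dvd a + b"
      then have "3 dvd gcd (a - 2 * b) (2 * a - b)" by (intro gcd_greatest; presburger)
      with 1 show False by simp
    qed
    ultimately show "coprime a b \<and> \<not> 3 dvd hexnorm a b" by (simp add: three)
  next
    assume *: "coprime a b \<and> \<not> 3 dvd hexnorm a b"
    have "coprime (a - 2 * b) (2 * a - b)"
    proof (rule ccontr)
      assume "\<not> ?thesis"
      moreover have "a - 2 * b \<noteq> 0 \<or> 2 * a - b \<noteq> 0"
        using * by auto
      ultimately obtain q where q: "prime q" "q dvd a - 2 * b" "q dvd 2 * a - b"
        using prime_divisor_exists[of "gcd (a - 2 * b) (2 * a - b)"] by (auto simp: is_unit_gcd)
      have "q dvd 2 * (2 * a - b) - (a - 2 * b)" "q dvd (2 * a - b) - 2 * (a - 2 * b)"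
        using q by (meson dvd_diff dvd_mult)+
      then have "q dvd 3 * a" "q dvd 3 * b" by (simp_all add: algebra_simps)
      then consider "q dvd 3" | "q dvd a" "q dvd b" using q by (auto simp: prime_dvd_mult_iff)
      then show False
      proof cases
        case 1
        then have "q = 3" using q \<open>prime (3::int)\<close> primes_dvd_imp_eq by blast
        then have "3 dvd a + b" using q by presburger
        then show ?thesis using * three by simp
      next
        case 2
        then show ?thesis using * q by (metis coprime_common_divisor not_prime_unit)
      qed
    qed
    then show "gcd (a - 2 * b) (2 * a - b) = 1" by simp
  qed
qed

lemma primitive_hex_mult_theta:
  "primitive (hex a b * theta) \<longleftrightarrow> gcd (a - 2 * b) (2 * a - b) = 1"
proof -
  have "hex a b * theta = hex (a - 2 * b) (2 * a - b)"
    by (simp add: theta_hex hex_mult mult.commute)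
  then show ?thesis
    by (simp add: primitive_def hex_inject flip: hex_def)
qed

lemma coprime_proportional:
  fixes c d X Y :: int
  assumes "coprime c d" "c * X = d * Y"
  obtains k where "X = d * k" "Y = c * k"
proof -
  obtain u v where uv: "u * c + v * d = 1"
    using bezout_int[of c d] assms(1) by (auto simp: coprime_iff_gcd_eq_1)
  have "X = u * (c * X) + d * (v * X)" "Y = c * (u * Y) + v * (d * Y)"
    using arg_cong[OF uv, of "\<lambda>z. z * X"] arg_cong[OF uv, of "\<lambda>z. z * Y"]
    by (simp_all add: algebra_simps)
  then have "X = u * (d * Y) + d * (v * X)" "Y = c * (u * Y) + v * (c * X)"
    by (simp_all only: assms(2))
  then have "X = d * (u * Y + v * X)" "Y = c * (u * Y + v * X)"
    by (simp_all only: distrib_left mult.left_commute)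
  then show ?thesis by (rule that)
qed

text \<open>Among the six neighbours of 0, those adjacent to alpha are alpha (1 + omega) and - alpha
  omega; the bounds against them cut the bisector of 0 and alpha down to an edge of the
  cell.\<close>

lemma hextrace_ne_hexnorm:
  assumes cop: "coprime (a - 2 * b) (2 * a - b)"
    and B: "\<bar>hextrace (- b) (a - b) p q\<bar> \<le> hexnorm a b"
    and AB: "\<bar>hextrace a b p q + hextrace (- b) (a - b) p q\<bar> \<le> hexnorm a b"
  shows "hextrace a b p q \<noteq> hexnorm a b"
proof
  define N where "N = hexnorm a b"
  assume A: "hextrace a b p q = hexnorm a b"
  \<comment> \<open>\<open>(p, q)\<close> lies on the perpendicular bisector of the segment from \<open>0\<close> to \<open>(a, b)\<close>;
    by primitivity the lattice points there are spaced too widely to meet the edge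
    of the cell away from its midpoint.\<close>
  have "(2 * a - b) * (2 * p - a) = (a - 2 * b) * (2 * q - b)"
    using A by (simp add: hextrace_def hexnorm_def power2_eq_square algebra_simps)
  then obtain k where k: "2 * p - a = (a - 2 * b) * k" "2 * q - b = (2 * a - b) * k"
    using cop coprime_proportional by (metis coprime_commute)
  then have pq: "2 * p = (a - 2 * b) * k + a" "2 * q = (2 * a - b) * k + b"
    by simp_all
  have "2 * hextrace (- b) (a - b) p q
      = - (2 * p) * (a + b) + (2 * q) * (2 * a - b)"
    by (simp add: hextrace_def algebra_simps)
  also have "\<dots> = - ((a - 2 * b) * k + a) * (a + b) + ((2 * a - b) * k + b) * (2 * a - b)"
    unfolding pq ..
  also have "\<dots> = N * (3 * k - 1)"
    by (simp add: N_def hexnorm_def power2_eq_square algebra_simps)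
  finally have B2: "2 * hextrace (- b) (a - b) p q = N * (3 * k - 1)" .
  have "(a, b) \<noteq> (0, 0)" using cop by auto
  then have N: "N > 0" by (simp add: N_def hexnorm_pos_iff)
  \<comment> \<open>For k >= 1 the trace against alpha (1 + omega) is at least 2 N; for k <= -1 the
    trace against alpha omega is at most -2 N.\<close>
  have "k = 0"
  proof (rule ccontr)
    assume "k \<noteq> 0"
    then consider "k \<ge> 1" | "3 * k - 1 \<le> - 4" by linarith
    then show False
    proof cases
      case 1
      then have "N * 2 \<le> 2 * hextrace (- b) (a - b) p q"
        unfolding B2 using N by (intro mult_left_mono) auto
      then show ?thesis using AB A N unfolding N_def by linarith
    next
      case 2
      then have "N * (3 * k - 1) \<le> N * (- 4)" using N by (intro mult_left_mono) auto
      then show ?thesis using B2 B N by (simp add: N_def)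
    qed
  qed
  with k have "a = 2 * p" "b = 2 * q" by auto
  then have "2 dvd a - 2 * b" "2 dvd 2 * a - b" by auto
  with cop show False by (metis coprime_common_divisor odd_one)
qed

text \<open>Each side of the hexagon is handled by \<open>hextrace_ne_hexnorm\<close> with alpha
  replaced by a unit multiple, which permutes the six signed traces and keeps alpha theta
  primitive.\<close>

lemma clean_mult_hex_if_coprime:
  assumes cop: "coprime (a - 2 * b) (2 * a - b)"
  shows "clean ((*) (hex a b) ` hex_lattice)"
proof -
  have ne: "a \<noteq> 0 \<or> b \<noteq> 0" using cop by auto
  have False
    if *: "\<bar>A\<bar> \<le> N" "\<bar>B\<bar> \<le> N" "\<bar>A + B\<bar> \<le> N" "\<bar>A\<bar> = N \<or> \<bar>B\<bar> = N \<or> \<bar>A + B\<bar> = N"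
      and defs: "A = hextrace a b p q" "B = hextrace (- b) (a - b) p q" "N = hexnorm a b"
    for A B N p q
  proof -
    have N: "hexnorm a b = N" "hexnorm (- a) (- b) = N" "hexnorm (- b) (a - b) = N"
      "hexnorm b (b - a) = N" "hexnorm (b - a) (- a) = N" "hexnorm (a - b) a = N"
      by (simp_all add: defs hexnorm_def power2_eq_square algebra_simps)
    have T: "hextrace a b p q = A" "hextrace (- a) (- b) p q = - A"
       "hextrace (- b) (a - b) p q = B" "hextrace b (b - a) p q = - B"
       "hextrace (b - a) (- a) p q = - A - B" "hextrace (a - b) a p q = A + B"
      by (simp_all add: defs hextrace_def algebra_simps)
    \<comment> \<open>Here u + v omega is alpha theta, and the pairs listed in \<open>uv\<close> are
      the coordinates of its six unit multiples.\<close>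
    define u v where "u = a - 2 * b" and "v = 2 * a - b"
    have uv1: "coprime u v" using cop by (simp add: u_def v_def)
    have uv2: "coprime (v - u) u"
      using uv1 gcd_diff1[of v u] by (simp add: coprime_iff_gcd_eq_1 gcd.commute[of v u])
    have uv3: "coprime (u - v) v"
      using uv1 gcd_diff1[of u v] by (simp add: coprime_iff_gcd_eq_1)
    have "coprime (- u) (- v)" using uv1 by simp
    moreover have "coprime (- v) (u - v)"
      using uv3 by (simp add: coprime_commute[of v])
    moreover have "coprime v (v - u)"
      using uv3 coprime_minus_left_iff[of "u - v" v] by (simp add: coprime_commute[of v])
    moreover have "coprime (v - u) (- u)" using uv2 by simp
    moreover have "coprime (u - v) u"
      using uv2 coprime_minus_left_iff[of "v - u" u] by simp
    moreover note uv1
    ultimately have uv: "coprime u v" "coprime (- u) (- v)" "coprime (- v) (u - v)" "coprime v (v - u)"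
      "coprime (v - u) (- u)" "coprime (u - v) u" by blast+
    have C: "coprime (a - 2 * b) (2 * a - b)"
      "coprime (- a - 2 * - b) (2 * - a - - b)"
      "coprime (- b - 2 * (a - b)) (2 * - b - (a - b))"
      "coprime (b - 2 * (b - a)) (2 * b - (b - a))"
      "coprime ((b - a) - 2 * - a) (2 * (b - a) - - a)"
      "coprime ((a - b) - 2 * a) (2 * (a - b) - a)"
    proof -
      have "- a - 2 * - b = - u" "2 * - a - - b = - v" "- b - 2 * (a - b) = - v"
        "2 * - b - (a - b) = u - v" "b - 2 * (b - a) = v" "2 * b - (b - a) = v - u"
        "(b - a) - 2 * - a = v - u" "2 * (b - a) - - a = - u" "(a - b) - 2 * a = u - v"
        "2 * (a - b) - a = u"
        by (simp_all add: u_def v_def)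
      note eqs = this
      show "coprime (a - 2 * b) (2 * a - b)"
        "coprime (- a - 2 * - b) (2 * - a - - b)"
        "coprime (- b - 2 * (a - b)) (2 * - b - (a - b))"
        "coprime (b - 2 * (b - a)) (2 * b - (b - a))"
        "coprime ((b - a) - 2 * - a) (2 * (b - a) - - a)"
        "coprime ((a - b) - 2 * a) (2 * (a - b) - a)"
        using uv cop by (simp_all only: eqs)
    qed
    have "A \<noteq> N"
      using hextrace_ne_hexnorm[OF C(1), of p q] *(1-3) by (simp add: N T)
    have "- A \<noteq> N"
      using hextrace_ne_hexnorm[OF C(2), of p q] *(1-3) by (simp add: N T)
    have "B \<noteq> N"
      using hextrace_ne_hexnorm[OF C(3), of p q] *(1-3) by (simp add: N T)
    have "- B \<noteq> N"
      using hextrace_ne_hexnorm[OF C(4), of p q] *(1-3) by (simp add: N T)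
    have "- A - B \<noteq> N"
      using hextrace_ne_hexnorm[OF C(5), of p q] *(1-3) by (simp add: N T)
    have "A + B \<noteq> N"
      using hextrace_ne_hexnorm[OF C(6), of p q] *(1-3) by (simp add: N T)
    have "\<bar>A\<bar> \<noteq> N" using \<open>A \<noteq> N\<close> \<open>- A \<noteq> N\<close> by linarith
    moreover have "\<bar>B\<bar> \<noteq> N" using \<open>B \<noteq> N\<close> \<open>- B \<noteq> N\<close> by linarith
    moreover have "\<bar>A + B\<bar> \<noteq> N" using \<open>A + B \<noteq> N\<close> \<open>- A - B \<noteq> N\<close> by linarith
    ultimately show False using *(4) by blast
  qed
  then show ?thesis
    unfolding clean_mult_hex_iff_hextrace[OF ne] Let_def by blast
qed

text \<open>The witnesses are \<open>\<alpha> (1/2 - \<theta>/(2 m))\<close>, on the edge of the cell towards \<open>\<alpha>\<close>: this is a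
  vertex for \<open>m = 3\<close> and lies on the edge for every \<open>m \<ge> 3\<close>. If the gcd of \<open>a\<close> and \<open>b\<close> is even,
  the midpoint \<open>\<alpha>/2\<close> of the edge is used instead.\<close>

lemma not_clean_mult_hex:
  assumes ne: "a \<noteq> 0 \<or> b \<noteq> 0" and "\<not> coprime a b \<or> 3 dvd hexnorm a b"
  shows "\<not> clean ((*) (hex a b) ` hex_lattice)"
proof -
  define N where "N = hexnorm a b"
  have N: "N > 0" using ne by (simp add: N_def hexnorm_pos_iff)
  have I: ?thesis if "hextrace a b p q = N" "\<bar>hextrace (- b) (a - b) p q\<bar> \<le> N"
    "\<bar>hextrace a b p q + hextrace (- b) (a - b) p q\<bar> \<le> N" for p q
  proof -
    have "\<bar>hextrace a b p q\<bar> \<le> N" "\<bar>hextrace a b p q\<bar> = N" using that N by auto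
    with that show ?thesis
      unfolding clean_mult_hex_iff_hextrace[OF ne] Let_def N_def by blast
  qed
  show ?thesis
  proof (cases "coprime a b")
    case True
    have "hexnorm a b = (a + b) * (a + b) - 3 * (a * b)"
      by (simp add: hexnorm_def power2_eq_square algebra_simps)
    with True assms have "3 dvd (a + b) * (a + b)" by (simp add: dvd_diff_left_iff)
    then have "3 dvd a + b" by (simp add: prime_dvd_mult_iff)
    then obtain k where "a + b = 3 * k" ..
    then have a: "a = 3 * k - b" by simp
    \<comment> \<open>The witness is alpha (1 - omega) / 3, the vertex equidistant from 0, alpha and
      - alpha omega; it is a lattice point because 3 divides a + b.\<close>
    show ?thesis
      by (rule I[of k "b - k"])
        (use N in \<open>simp_all add: a N_def hextrace_def hexnorm_def power2_eq_square algebra_simps\<close>)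
  next
    case False
    define m where "m = gcd a b"
    have m: "m \<ge> 2"
  proof -
    have "m \<noteq> 0" "m \<noteq> 1" "m \<ge> 0"
      using False ne by (auto simp: m_def coprime_iff_gcd_eq_1)
    then show ?thesis by linarith
  qed
    obtain a' b' where ab: "a = m * a'" "b = m * b'" 
      using gcd_dvd1[of a b] gcd_dvd2[of a b] unfolding m_def dvd_def by blast
    have N': "N = m * m * hexnorm a' b'"
      by (simp add: N_def ab hexnorm_def power2_eq_square algebra_simps)
    have n: "hexnorm a' b' \<ge> 0" by (rule hexnorm_nonneg)
    show ?thesis
    proof (cases "even m")
      case True
      then obtain k where k: "m = 2 * k" ..
      have T: "hextrace a b (k * a') (k * b') = N"
        "hextrace (- b) (a - b) (k * a') (k * b') = - (2 * k * k * hexnorm a' b')"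
        unfolding N'
        by (simp_all add: ab k hextrace_def hexnorm_def power2_eq_square algebra_simps)
      have "k * k * hexnorm a' b' \<ge> 0" using n by simp
      then show ?thesis
        by (intro I[OF T(1)]; unfold T N') (simp_all add: k algebra_simps)
    next
      case False
      then obtain k where k: "m = 2 * k + 1" by (rule oddE)
      \<comment> \<open>With alpha = m alpha' the witness is alpha' (k - omega). It stays on the
        edge because m >= 3 gives k + 2 <= m.\<close>
      have T: "hextrace a b (a' * k + b') (b' * (k + 1) - a') = N"
        "hextrace (- b) (a - b) (a' * k + b') (b' * (k + 1) - a') = - (m * (k + 2) * hexnorm a' b')"
        unfolding N'
        by (simp_all add: ab k hextrace_def hexnorm_def power2_eq_square algebra_simps)
      have "m * (k + 2) \<le> m * m" "m * (k + 2) \<ge> 0"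
        using m k by simp_all
      then have "m * (k + 2) * hexnorm a' b' \<le> m * m * hexnorm a' b'"
        "m * (k + 2) * hexnorm a' b' \<ge> 0"
        using n by (simp_all only: mult_right_mono mult_nonneg_nonneg)
      then show ?thesis
        by (intro I[OF T(1)]; unfold T N') linarith+
    qed
  qed
qed

lemma clean_mult_hex_iff:
  assumes ne: "a \<noteq> 0 \<or> b \<noteq> 0"
  shows "clean ((*) (hex a b) ` hex_lattice) \<longleftrightarrow> gcd (a - 2 * b) (2 * a - b) = 1"
  using clean_mult_hex_if_coprime[of a b] not_clean_mult_hex[OF ne] coprime_hexnorm_iff[of a b]
  unfolding coprime_iff_gcd_eq_1 by argo

section \<open>Index and similarity\<close>

text \<open>For z = p + q omega, \<open>q * a - p * b\<close> is the omega-coordinate of z cnj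
  alpha, a product that equals N beta when z = alpha beta. Coprimality lets this single coordinate
  decide divisibility by alpha.\<close>

lemma mult_hex_mem_iff:
  assumes cop: "coprime a b"
  shows "hex p q \<in> (*) (hex a b) ` hex_lattice \<longleftrightarrow> hexnorm a b dvd q * a - p * b"
proof
  assume "hex p q \<in> (*) (hex a b) ` hex_lattice"
  then obtain r s where pq: "p = a * r - b * s" "q = a * s + b * r - b * s"
    by (auto simp: mult_hex_lattice hex_mult hex_inject)
  have "q * a - p * b = hexnorm a b * s"
    unfolding pq by (simp add: hexnorm_def power2_eq_square algebra_simps)
  then show "hexnorm a b dvd q * a - p * b" by simp
next
  assume "hexnorm a b dvd q * a - p * b"
  then obtain s where s: "q * a - p * b = hexnorm a b * s" ..
  then have "a * (q - a * s + b * s) = b * (p + b * s)"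
    by (simp add: hexnorm_def power2_eq_square algebra_simps)
  with cop obtain r where "q - a * s + b * s = b * r" "p + b * s = a * r"
    by (rule coprime_proportional)
  then have "hex p q = hex a b * hex r s"
    by (simp add: hex_mult hex_inject algebra_simps)
  then show "hex p q \<in> (*) (hex a b) ` hex_lattice" by auto
qed

text \<open>A first isomorphism theorem for maps of sets, used to count cosets by the residues of a
  linear form.\<close>

lemma card_image_eq_if_same_kernel:
  assumes "\<And>x y. x \<in> S \<Longrightarrow> y \<in> S \<Longrightarrow> f x = f y \<longleftrightarrow> g x = g y"
  shows "card (f ` S) = card (g ` S)"
proof (rule bij_betw_same_card)
  show "bij_betw (\<lambda>u. g (inv_into S f u)) (f ` S) (g ` S)"
  proof (rule bij_betwI')
    fix u v assume "u \<in> f ` S" "v \<in> f ` S"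
    then show "g (inv_into S f u) = g (inv_into S f v) \<longleftrightarrow> u = v"
      using assms by (metis f_inv_into_f inv_into_into)
  next
    fix u assume "u \<in> f ` S"
    then show "g (inv_into S f u) \<in> g ` S" by (simp add: inv_into_into)
  next
    fix v assume "v \<in> g ` S"
    then obtain x where "x \<in> S" "v = g x" by blast
    then show "\<exists>u\<in>f ` S. v = g (inv_into S f u)"
      using assms by (metis f_inv_into_f imageI inv_into_into)
  qed
qed

lemma sublattice_index_mult_hex:
  assumes cop: "coprime a b"
  shows "sublattice_index ((*) (hex a b) ` hex_lattice) = nat (hexnorm a b)"
proof -
  define M where "M = (*) (hex a b) ` hex_lattice"
  define N where "N = hexnorm a b"
  define f where "f = (\<lambda>(p, q). (q * a - p * b) mod N)"
  have "(a, b) \<noteq> (0, 0)" using cop by auto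
  then have N: "N > 0" by (simp add: N_def hexnorm_pos_iff)
  have MI: "hex a b * hex r s \<in> M" for r s by (auto simp: M_def)
  have closed: "x - y \<in> M \<and> x + y \<in> M" if xy: "x \<in> M" "y \<in> M" for x y
  proof -
    obtain r s r' s' where "x = hex a b * hex r s" "y = hex a b * hex r' s'"
      using xy by (auto simp: M_def mult_hex_lattice)
    then have "x - y = hex a b * hex (r - r') (s - s')" "x + y = hex a b * hex (r + r') (s + s')"
      by (simp_all add: right_diff_distrib distrib_left flip: hex_diff hex_add)
    then show ?thesis using MI by simp
  qed
  then have diff: "\<And>x y. x \<in> M \<Longrightarrow> y \<in> M \<Longrightarrow> x - y \<in> M"
    and add: "\<And>x y. x \<in> M \<Longrightarrow> y \<in> M \<Longrightarrow> x + y \<in> M" by simp_all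
  have coset: "(+) x ` M = (+) y ` M \<longleftrightarrow> x - y \<in> M" for x y
  proof
    have "0 \<in> M" unfolding M_def by (rule image_eqI[of _ _ "hex 0 0"]) (simp_all add: hex_eq_0_iff)
    moreover assume "(+) x ` M = (+) y ` M"
    ultimately obtain m where "m \<in> M" "x + 0 = y + m" by blast
    then show "x - y \<in> M" by (simp add: algebra_simps)
  next
    assume xy: "x - y \<in> M"
    have "x + m = y + (m + (x - y))" "y + m = x + (m - (x - y))" for m by simp_all
    then show "(+) x ` M = (+) y ` M" using add[OF _ xy] diff[OF _ xy]
      by (intro equalityI image_subsetI) (metis imageI)+
  qed
  have "sublattice_index M = card ((\<lambda>v. (+) (case_prod hex v) ` M) ` UNIV)"
    by (simp add: sublattice_index_def hex_lattice_eq image_image)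
  also have "\<dots> = card (f ` UNIV)"
  proof (rule card_image_eq_if_same_kernel)
    fix v w :: "int \<times> int"
    obtain p q r s where vw: "v = (p, q)" "w = (r, s)" by fastforce
    have "(+) (hex p q) ` M = (+) (hex r s) ` M \<longleftrightarrow> N dvd (q - s) * a - (p - r) * b"
      unfolding coset hex_diff unfolding M_def N_def mult_hex_mem_iff[OF cop] ..
    also have "\<dots> \<longleftrightarrow> (q * a - p * b) mod N = (s * a - r * b) mod N"
      by (simp add: mod_eq_dvd_iff algebra_simps)
    finally show "(+) (case_prod hex v) ` M = (+) (case_prod hex w) ` M \<longleftrightarrow> f v = f w"
      by (simp add: vw f_def)
  qed
  also have "f ` UNIV = {0..<N}"
  proof (intro equalityI subsetI)
    fix n assume "n \<in> f ` UNIV"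
    then show "n \<in> {0..<N}" using N by (auto simp: f_def)
  next
    fix n assume n: "n \<in> {0..<N}"
    obtain u v where uv: "u * a + v * b = 1"
      using bezout_int[of a b] cop by (auto simp: coprime_iff_gcd_eq_1)
    have "(u * n) * a - (- v * n) * b = n * (u * a + v * b)"
      by (simp add: algebra_simps)
    then have "(u * n) * a - (- v * n) * b = n" by (simp only: uv mult_1_right)
    then have "f (- v * n, u * n) = n" using n by (simp add: f_def)
    then show "n \<in> f ` UNIV" by (metis UNIV_I imageI)
  qed
  finally show ?thesis by (simp add: M_def N_def)
qed

lemma inner_mult_left_complex:
  fixes c u v :: complex
  shows "(c * u) \<bullet> (c * v) = (norm c)\<^sup>2 * (u \<bullet> v)"
  unfolding cmod_power2 by (simp add: inner_complex_def power2_eq_square algebra_simps)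

lemma similar_sublattice_mult_hex:
  assumes "a \<noteq> 0 \<or> b \<noteq> 0"
  shows "similar_sublattice ((*) (hex a b) ` hex_lattice)"
proof -
  have "linear ((*) (hex a b))" by (simp add: bounded_linear.linear bounded_linear_mult_right)
  moreover have "(norm (hex a b))\<^sup>2 > 0" using assms by (simp add: hex_eq_0_iff)
  ultimately show ?thesis
    unfolding similar_sublattice_def
    using mult_hex_lattice_subset inner_mult_left_complex by blast
qed

text \<open>The quotient of the images of omega and 1 has norm 1 and real part -1/2, so it is omega
  or its conjugate. Hence the similarity is multiplication by the image of 1, possibly preceded by
  conjugation.\<close>

lemma similar_sublatticeE:
  assumes "similar_sublattice M"
  obtains a b where "a \<noteq> 0 \<or> b \<noteq> 0" "M = (*) (hex a b) ` hex_lattice"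
proof -
  from assms obtain \<sigma> :: "complex \<Rightarrow> complex" and k where
    sub: "M \<subseteq> hex_lattice" and lin: "linear \<sigma>" and "k > 0" and
    k: "\<And>u v. \<sigma> u \<bullet> \<sigma> v = k * (u \<bullet> v)" and M: "M = \<sigma> ` hex_lattice"
    unfolding similar_sublattice_def by blast
  have img: "\<sigma> (hex r s) = of_int r * \<sigma> 1 + of_int s * \<sigma> omega" for r s
  proof -
    have "hex r s = of_int r *\<^sub>R 1 + of_int s *\<^sub>R omega"
      by (simp add: hex_def scaleR_conv_of_real)
    then have "\<sigma> (hex r s) = of_int r *\<^sub>R \<sigma> 1 + of_int s *\<^sub>R \<sigma> omega"
      by (simp only: linear_add[OF lin] linear_scale[OF lin])
    then show ?thesis by (simp add: scaleR_conv_of_real)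
  qed
  have "\<sigma> (hex 1 0) \<in> hex_lattice" using sub M by blast
  then obtain a b where ab: "\<sigma> 1 = hex a b" by (auto simp: img elim: hex_latticeE)
  define \<tau> where "\<tau> = \<sigma> omega / \<sigma> 1"
  have n1: "(norm (\<sigma> 1))\<^sup>2 = k"
    using k[of 1 1] by (simp add: power2_norm_eq_inner)
  then have nz: "\<sigma> 1 \<noteq> 0" using \<open>k > 0\<close> by auto
  then have \<tau>: "\<sigma> omega = \<sigma> 1 * \<tau>" by (simp add: \<tau>_def)
  have "k * (\<tau> \<bullet> \<tau>) = k * (omega \<bullet> omega)" "k * (1 \<bullet> \<tau>) = k * (1 \<bullet> omega)"
    using k[of omega omega] k[of 1 omega] inner_mult_left_complex[of "\<sigma> 1" \<tau> \<tau>]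
      inner_mult_left_complex[of "\<sigma> 1" 1 \<tau>]
    by (auto simp: \<tau> n1)
  then have "\<tau> \<bullet> \<tau> = omega \<bullet> omega" "1 \<bullet> \<tau> = 1 \<bullet> omega"
    using mult_left_cancel[of k] \<open>k > 0\<close> by (metis less_irrefl)+
  then have "\<tau> \<bullet> \<tau> = 1" "Re \<tau> = - 1 / 2"
    by (simp_all add: omega_Complex inner_complex_def)
  then have "(Im \<tau>)\<^sup>2 = (sqrt 3 / 2)\<^sup>2"
    by (simp add: inner_complex_def power2_eq_square)
  then have "Im \<tau> = sqrt 3 / 2 \<or> Im \<tau> = - (sqrt 3 / 2)"
    by (simp only: power2_eq_iff)
  then have cases: "\<tau> = hex 0 1 \<or> \<tau> = hex (- 1) (- 1)"
    using \<open>Re \<tau> = - 1 / 2\<close> by (auto simp: hex_def omega_Complex complex_eq_iff)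
  have "M = (*) (hex a b) ` hex_lattice"
    using cases
  proof
    assume "\<tau> = hex 0 1"
    then have "\<sigma> (hex r s) = hex a b * hex r s" for r s
      by (simp add: img \<tau> ab) (simp add: hex_def algebra_simps)
    then show ?thesis unfolding M by (intro image_cong refl) (auto elim!: hex_latticeE)
  next
    \<comment> \<open>The orientation-reversing case: the lattice is invariant under complex conjugation.\<close>
    assume "\<tau> = hex (- 1) (- 1)"
    then have eq: "\<sigma> (hex r s) = hex a b * hex (r - s) (- s)" for r s
      by (simp add: img \<tau> ab) (simp add: hex_def algebra_simps)
    show ?thesis
    proof (intro equalityI subsetI)
      fix z assume "z \<in> M"
      then show "z \<in> (*) (hex a b) ` hex_lattice" by (auto simp: M eq elim!: hex_latticeE)
    next
      fix z assume "z \<in> (*) (hex a b) ` hex_lattice"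
      then obtain r s where "z = hex a b * hex r s" by (auto elim!: hex_latticeE)
      then have "z = \<sigma> (hex (r - s) (- s))" by (simp add: eq)
      then show "z \<in> M" by (auto simp: M)
    qed
  qed
  then show ?thesis using nz that by (simp add: ab hex_eq_0_iff)
qed

section \<open>Primitive representations by the norm form\<close>

lemma fermat_theorem_int:
  assumes p: "prime p" and a: "\<not> int p dvd a"
  shows "[a ^ (p - 1) = 1] (mod int p)"
proof -
  define n where "n = nat (a mod int p)"
  have "p > 0" using p by (simp add: prime_gt_0_nat)
  then have n: "int n = a mod int p" by (simp add: n_def)
  then have an: "[a = int n] (mod int p)" by (simp add: cong_def)
  have "\<not> p dvd n"
    using a n by (metis dvd_mod_iff dvd_refl int_dvd_int_iff)
  then have "[int (n ^ (p - 1)) = int 1] (mod int p)"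
    using fermat_theorem[OF p] by (simp only: cong_int_iff)
  then have "[int n ^ (p - 1) = 1] (mod int p)" by simp
  then show ?thesis using cong_pow[OF an] cong_trans by blast
qed

text \<open>If p = 3 k + 2, cubing is injective modulo p, so a^3 + b^3 = (a + b) N gives a = -b
  modulo p. Then p divides 3 a b, although it divides none of 3, a, b.\<close>

lemma prime_dvd_hexnorm_cong_1_mod_3:
  assumes cop: "coprime a b" and three: "\<not> 3 dvd hexnorm a b"
    and p: "prime p" and dvd: "int p dvd hexnorm a b"
  shows "[p = 1] (mod 3)"
proof (rule ccontr)
  assume "\<not> ?thesis"
  then have "p mod 3 = 0 \<or> p mod 3 = 2" unfolding cong_def by auto
  moreover have "p mod 3 \<noteq> 0"
  proof
    assume "p mod 3 = 0"
    then have "p = 3" using p by (metis dvd_eq_mod_eq_0 prime_nat_iff numeral_eq_one_iff semiring_norm(84))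
    then show False using three dvd by simp
  qed
  ultimately have "p mod 3 = 2" by blast
  then obtain k where k: "p = 3 * k + 2" by (metis mult_div_mod_eq)
  have P: "prime (int p)" using p by simp
  have N: "hexnorm a b = (a + b) * (a + b) - 3 * (a * b)" "hexnorm a b = a * a - b * (a - b)"
    "hexnorm a b = b * b - a * (b - a)"
    by (simp_all add: hexnorm_def power2_eq_square algebra_simps)
  have nab: "\<not> (int p dvd a \<and> int p dvd b)"
    using cop P by (metis coprime_common_divisor not_prime_unit)
  have na: "\<not> int p dvd a"
  proof
    assume pa: "int p dvd a"
    then have "int p dvd b * b" using dvd unfolding N(3) by (simp add: dvd_diff_left_iff)
    then show False using nab pa P by (simp add: prime_dvd_mult_iff)
  qed
  have nb: "\<not> int p dvd b"
  proof
    assume pb: "int p dvd b"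
    then have "int p dvd a * a" using dvd unfolding N(2) by (simp add: dvd_diff_left_iff)
    then show False using nab pb P by (simp add: prime_dvd_mult_iff)
  qed
  have "int p dvd a + b"
  proof (cases "p = 2")
    case True
    then show ?thesis using na nb by simp
  next
    case False
    then have "odd p" using p prime_odd_nat prime_ge_2_nat by (metis le_neq_implies_less)
    then have "odd k" using k by simp
    have "a ^ 3 - (- b) ^ 3 = (a + b) * hexnorm a b"
      by (simp add: hexnorm_def power2_eq_square power3_eq_cube algebra_simps)
    then have "[a ^ 3 = (- b) ^ 3] (mod int p)" using dvd by (simp add: cong_iff_dvd_diff)
    then have "[(a ^ 3) ^ k = ((- b) ^ 3) ^ k] (mod int p)" by (rule cong_pow)
    then have cube: "[a ^ (3 * k) = - (b ^ (3 * k))] (mod int p)"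
      using \<open>odd k\<close> by (simp add: power_mult)
    \<comment> \<open>Since p - 1 = 3 k + 1, Fermat makes a^(3 k) and b^(3 k) inverses of a and b;
      multiplying by a b turns the congruence into b = -a.\<close>
    have "[a ^ (3 * k) * a * b = - (b ^ (3 * k)) * a * b] (mod int p)"
      by (intro cong_mult cong_refl cube)
    moreover have "p - 1 = Suc (3 * k)" using k by simp
    then have fa: "[a ^ (3 * k) * a = 1] (mod int p)" and fb: "[b ^ (3 * k) * b = 1] (mod int p)"
      using fermat_theorem_int[OF p na] fermat_theorem_int[OF p nb] by (simp_all add: mult.commute)
    moreover have "[a ^ (3 * k) * a * b = 1 * b] (mod int p)"
      by (intro cong_mult cong_refl fa)
    moreover have "[(b ^ (3 * k) * b) * (- a) = 1 * (- a)] (mod int p)"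
      by (intro cong_mult cong_refl fb)
    moreover have "(b ^ (3 * k) * b) * (- a) = - (b ^ (3 * k)) * a * b" by simp
    ultimately have "[1 * b = 1 * (- a)] (mod int p)"
      by (metis cong_sym cong_trans)
    then have "int p dvd b - - a" by (simp only: cong_iff_dvd_diff mult_1)
    then show ?thesis by (simp add: add.commute)
  qed
  then have "int p dvd 3 * (a * b)"
    using dvd unfolding N(1) by (metis dvd_diff_right_iff dvd_mult)
  then have "int p dvd 3" using na nb P by (simp add: prime_dvd_mult_iff)
  then have "p dvd 3" by (metis int_dvd_int_iff of_nat_numeral)
  then have "p \<le> 3" by (simp add: dvd_imp_le)
  with k have "p = 2" by simp
  with \<open>p dvd 3\<close> show False by simp
qed

text \<open>Induction on \<open>c\<close>: reducing \<open>t\<close> modulo \<open>c\<close> makes the cofactor \<open>d\<close> of \<open>c\<close> in the norm of \<open>t + \<omega>\<close>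
  smaller than \<open>c\<close>; a factorisation with norms \<open>d\<close> and \<open>c\<close> is then read backwards.\<close>

lemma hexnorm_represents_divisor:
  assumes "c > 0" "c dvd hexnorm t 1"
  shows "\<exists>a b e f. a * e - b * f = t \<and> a * f + b * e - b * f = 1 \<and> hexnorm a b = c"
  using assms
proof (induction "nat c" arbitrary: c t rule: less_induct)
  case less
  show ?case
  proof (cases "c = 1")
    case True
    then show ?thesis
      by (intro exI[of _ 1] exI[of _ 0] exI[of _ t]) (simp add: hexnorm_def)
  next
    case False
    with less.prems have c: "c \<ge> 2" by simp
    \<comment> \<open>This choice puts u = t - m c within c / 2 of 1/2, where the norm of u + omega
      is smallest.\<close>
    define m where "m = (2 * t - 1 + c) div (2 * c)"
    define u where "u = t - m * c"
    have "2 * u - 1 = (2 * t - 1 + c) mod (2 * c) - c"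
      using mult_div_mod_eq[of "2 * c" "2 * t - 1 + c"]
      by (simp add: u_def m_def algebra_simps)
    moreover have "0 \<le> (2 * t - 1 + c) mod (2 * c)" "(2 * t - 1 + c) mod (2 * c) < 2 * c"
      using c by simp_all
    ultimately have "\<bar>2 * u - 1\<bar> \<le> \<bar>c\<bar>" by linarith
    then have "(2 * u - 1)\<^sup>2 \<le> c\<^sup>2" by (simp only: abs_le_square_iff)
    then have "4 * hexnorm u 1 \<le> c\<^sup>2 + 3" by (simp add: four_hexnorm)
    moreover have "c * c \<ge> 2 * 2" using c by (intro mult_mono) auto
    ultimately have lt: "hexnorm u 1 < c * c" by (simp add: power2_eq_square)
    have "hexnorm u 1 = hexnorm t 1 + c * (m * (m * c - 2 * t + 1))"
      by (simp add: u_def hexnorm_def power2_eq_square algebra_simps)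
    with less.prems have "c dvd hexnorm u 1" by simp
    then obtain d where d: "hexnorm u 1 = c * d" ..
    have "hexnorm u 1 > 0" by (simp add: hexnorm_pos_iff)
    with d c have "d > 0" by (simp add: zero_less_mult_iff)
    have "d < c" using lt c unfolding d by simp
    then obtain a b e f where
      eq: "a * e - b * f = u" "a * f + b * e - b * f = 1" "hexnorm a b = d"
      using less.hyps[of d u] \<open>d > 0\<close> d by auto
    have "hexnorm a b * hexnorm e f = c * d"
      using hexnorm_mult[of a e b f] unfolding eq d by (simp only:)
    with eq \<open>d > 0\<close> have N: "hexnorm e f = c" by simp
    \<comment> \<open>Let beta = e + f omega, of norm c. Adding m c = m beta cnj beta to u + omega =
      (a + b omega) beta gives t + omega = beta (a + b omega + m cnj beta).\<close>
    have "e * (a + m * (e - f)) - f * (b - m * f) = (a * e - b * f) + m * hexnorm e f"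
      by (simp add: hexnorm_def power2_eq_square algebra_simps)
    then have "e * (a + m * (e - f)) - f * (b - m * f) = t"
      unfolding eq N by (simp add: u_def)
    moreover have "e * (b - m * f) + f * (a + m * (e - f)) - f * (b - m * f) = 1"
      using eq(2) by (simp add: algebra_simps)
    ultimately show ?thesis using N by blast
  qed
qed

text \<open>A primitive root raised to the power (p - 1) / 3 is a nontrivial cube root of unity t
  modulo p, so p divides t^2 + t + 1, the norm of -t + omega.\<close>

lemma prime_1_mod_3_root:
  assumes p: "prime p" "[p = 1] (mod 3)"
  obtains t where "int p dvd hexnorm t 1"
proof -
  obtain g where g: "residue_primroot p g"
    using prime_primitive_root_exists[of p] p prime_gt_1_nat by blast
  have ord: "ord p g = p - 1"
    using g p by (simp add: residue_primroot_def totient_prime)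
  have "3 dvd p - 1" using p by (metis cong_altdef_nat cong_def mod_eq_dvd_iff_nat prime_ge_1_nat)
  then obtain k where k: "p - 1 = 3 * k" ..
  have "k > 0" using k p prime_gt_1_nat[of p] by (cases k) auto
  define t where "t = int (g ^ k)"
  have P: "prime (int p)" using p by simp
  have "[g ^ (3 * k) = 1] (mod p)" using ord k unfolding ord_divides by simp
  then have "[int (g ^ (3 * k)) = int 1] (mod int p)" by (simp only: cong_int_iff)
  then have "int p dvd t ^ 3 - 1"
    by (simp add: t_def cong_iff_dvd_diff mult.commute flip: power_mult)
  moreover have "t ^ 3 - 1 = (t - 1) * hexnorm (- t) 1"
    by (simp add: hexnorm_def power2_eq_square power3_eq_cube algebra_simps)
  moreover have "\<not> int p dvd t - 1"
  proof
    assume "int p dvd t - 1"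
    then have "[int (g ^ k) = int 1] (mod int p)" by (simp add: t_def cong_iff_dvd_diff)
    then have "[g ^ k = 1] (mod p)" by (simp only: cong_int_iff)
    then have "p - 1 dvd k" unfolding ord_divides ord .
    then show False using k \<open>k > 0\<close> by (auto dest: dvd_imp_le)
  qed
  ultimately show ?thesis using P that by (auto simp: prime_dvd_mult_iff)
qed

text \<open>If both products of \<open>a + b \<omega>\<close> with an element of prime norm \<open>p\<close> and with its conjugate were
  imprimitive, then \<open>p\<close> would divide their sum and hence the trace of that element.\<close>

lemma coprime_hexnorm_mult_prime:
  assumes cop: "coprime a b" and c: "hexnorm a b = c"
    and p: "prime p" and xy: "hexnorm x y = p" "\<not> 3 dvd p"
  obtains a' b' where "coprime a' b'" "hexnorm a' b' = c * p"
proof -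
  have *: "p dvd a * x - b * y \<and> p dvd a * y + b * x - b * y"
    if "hexnorm x y = p" "\<not> coprime (a * x - b * y) (a * y + b * x - b * y)" for x y
  proof -
    define r s where "r = a * x - b * y" and "s = a * y + b * x - b * y"
    \<comment> \<open>With beta = x + y omega these are the coordinates of (alpha beta) cnj beta = p
      alpha. A prime dividing alpha beta therefore divides p alpha, and equals p because alpha is
      primitive.\<close>
    have ab: "r * (x - y) + s * y = p * a" "s * x - r * y = p * b"
      unfolding that(1)[symmetric]
      by (simp_all add: r_def s_def hexnorm_def power2_eq_square algebra_simps)
    have "p * a \<noteq> 0 \<or> p * b \<noteq> 0" using cop p by auto
    then have "gcd r s \<noteq> 0" unfolding ab[symmetric] by auto
    moreover have "\<not> is_unit (gcd r s)" 
      using that by (simp add: r_def s_def is_unit_gcd coprime_iff_gcd_eq_1)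
    ultimately obtain q where q: "prime q" "q dvd gcd r s"
      using prime_divisor_exists by blast
    then have "q dvd p * a" "q dvd p * b" unfolding ab[symmetric] by auto
    then have "q dvd p"
      using q(1) coprime_common_divisor[OF cop, of q] by (auto simp: prime_dvd_mult_iff)
    then have "q = p" using q p primes_dvd_imp_eq by blast
    then show ?thesis using q by (simp add: r_def s_def)
  qed
  have conj: "hexnorm (x - y) (- y) = p"
    using xy by (simp add: hexnorm_def power2_eq_square algebra_simps)
  have "coprime (a * x - b * y) (a * y + b * x - b * y) \<or>
      coprime (a * (x - y) - b * (- y)) (a * (- y) + b * (x - y) - b * (- y))"
  proof (rule ccontr)
    assume "\<not> ?thesis"
    with *[OF xy(1)] *[OF conj]
    have d: "p dvd a * x - b * y" "p dvd a * y + b * x - b * y"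
      "p dvd a * (x - y) - b * (- y)" "p dvd a * (- y) + b * (x - y) - b * (- y)" by blast+
    have "p dvd a * (2 * x - y)"
      using dvd_add[OF d(1,3)] by (simp add: algebra_simps)
    moreover have "p dvd b * (2 * x - y)"
      using dvd_add[OF d(2,4)] by (simp add: algebra_simps)
    ultimately have tr: "p dvd 2 * x - y"
      using p coprime_common_divisor[OF cop, of p] by (auto simp: prime_dvd_mult_iff)
    \<comment> \<open>As 4 p is the squared trace plus 3 y^2, p divides y and then x, so p^2 would
      divide the norm p.\<close>
    then have "p dvd (2 * x - y)\<^sup>2" by (simp add: power2_eq_square)
    moreover have "3 * y\<^sup>2 = 4 * p - (2 * x - y)\<^sup>2"
      using four_hexnorm[of x y] xy by simp
    ultimately have "p dvd 3 * y\<^sup>2" by simp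
    moreover have "\<not> p dvd 3"
      using primes_dvd_imp_eq[OF p, of 3] xy(2) by auto
    ultimately have y: "p dvd y" using p by (auto simp: prime_dvd_mult_iff prime_dvd_power_iff)
    have "x * x = p - y * (y - x)"
      using xy by (simp add: hexnorm_def power2_eq_square algebra_simps)
    with y have "p dvd x * x" by simp
    with p have "p dvd x" by (simp add: prime_dvd_mult_iff)
    then obtain m where m: "x = p * m" ..
    from y obtain n where n: "y = p * n" ..
    have "p * (p * hexnorm m n) = hexnorm x y"
      by (simp add: m n hexnorm_def power2_eq_square algebra_simps)
    also have "\<dots> = p * 1" using xy by simp
    finally have "p * hexnorm m n = 1"
      using mult_left_cancel[of p] p by (metis not_prime_0)
    then have "is_unit p" by (intro dvdI[of _ _ "hexnorm m n"]) simp
    with p show False using not_prime_unit by blast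
  qed
  then show ?thesis
  proof
    assume "coprime (a * x - b * y) (a * y + b * x - b * y)"
    then show ?thesis by (rule that) (simp add: hexnorm_mult c xy)
  next
    assume "coprime (a * (x - y) - b * (- y)) (a * (- y) + b * (x - y) - b * (- y))"
    then show ?thesis by (rule that) (simp only: hexnorm_mult c conj)
  qed
qed

lemma ex_coprime_hexnorm_iff:
  assumes "c > 0"
  shows "(\<exists>a b. coprime a b \<and> \<not> 3 dvd hexnorm a b \<and> hexnorm a b = int c) \<longleftrightarrow>
    (\<exists>P :: nat multiset. (\<forall>p\<in>#P. prime p \<and> [p = 1] (mod 3)) \<and> c = prod_mset P)"
    (is "?L \<longleftrightarrow> ?R")
proof
  assume ?L
  then obtain a b where ab: "coprime a b" "\<not> 3 dvd hexnorm a b" "hexnorm a b = int c" by blast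
  have "prime p \<and> [p = 1] (mod 3)" if "p \<in># prime_factorization c" for p
  proof -
    have "prime p" "p dvd c" using that by auto
    then show ?thesis using prime_dvd_hexnorm_cong_1_mod_3[OF ab(1,2), of p] ab(3) by simp
  qed
  moreover have "c = prod_mset (prime_factorization c)"
    using assms by (simp add: prod_mset_prime_factorization_nat)
  ultimately show ?R by blast
next
  assume ?R
  then obtain P :: "nat multiset"
    where P: "\<And>p. p \<in># P \<Longrightarrow> prime p \<and> [p = 1] (mod 3)" and c: "c = prod_mset P" by blast
  have "\<exists>a b. coprime a b \<and> \<not> 3 dvd hexnorm a b \<and> hexnorm a b = int (prod_mset P)"
    using P
  proof (induction P)
    case empty
    show ?case by (intro exI[of _ 1] exI[of _ 0]) (simp add: hexnorm_def)
  next
    case (add p P)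
    then obtain a b where ab: "coprime a b" "\<not> 3 dvd hexnorm a b" "hexnorm a b = int (prod_mset P)"
      by auto
    have p: "prime p" "[p = 1] (mod 3)" using add.prems by auto
    obtain t where "int p dvd hexnorm t 1" using p by (rule prime_1_mod_3_root)
    then obtain x y where xy: "hexnorm x y = int p"
      using hexnorm_represents_divisor[of "int p" t] p prime_gt_0_nat by auto
    have "p mod 3 = 1" using p by (simp add: cong_def)
    then have "int p mod 3 = 1" by (metis of_nat_1 of_nat_mod of_nat_numeral)
    then have p3: "\<not> 3 dvd int p" by presburger
    obtain a' b' where "coprime a' b'" "hexnorm a' b' = hexnorm a b * int p"
      using coprime_hexnorm_mult_prime[OF ab(1) refl _ xy p3] p by auto
    moreover have "\<not> 3 dvd hexnorm a b * int p"
      using ab p3 by (simp add: prime_dvd_mult_iff)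
    ultimately have "coprime a' b' \<and> \<not> 3 dvd hexnorm a' b' \<and>
        hexnorm a' b' = int (prod_mset (add_mset p P))"
      by (simp add: ab(3) mult.commute)
    then show ?case by blast
  qed
  then show ?L unfolding c .
qed

theorem theorem5:
  "(\<forall>a b :: int. \<forall>\<alpha> :: complex.
      \<alpha> = of_int a + of_int b * omega \<longrightarrow> \<alpha> \<noteq> 0 \<longrightarrow>
      (clean ((*) \<alpha> ` hex_lattice) \<longleftrightarrow> primitive (\<alpha> * theta))) \<and>
   (\<forall>c :: nat. c > 0 \<longrightarrow>
      ((\<exists>M. similar_sublattice M \<and> clean M \<and> sublattice_index M = c) \<longleftrightarrow>
       (\<exists>P :: nat multiset. (\<forall>p\<in>#P. prime p \<and> [p = 1] (mod 3)) \<and> c = prod_mset P)))"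
proof (intro conjI allI impI)
  fix a b :: int and \<alpha> :: complex
  assume "\<alpha> = of_int a + of_int b * omega" "\<alpha> \<noteq> 0"
  then have \<alpha>: "\<alpha> = hex a b" "a \<noteq> 0 \<or> b \<noteq> 0" by (auto simp: hex_def)
  show "clean ((*) \<alpha> ` hex_lattice) \<longleftrightarrow> primitive (\<alpha> * theta)"
    unfolding \<alpha>(1) clean_mult_hex_iff[OF \<alpha>(2)] primitive_hex_mult_theta ..
next
  fix c :: nat assume c: "c > 0"
  \<comment> \<open>By \<open>coprime_hexnorm_iff\<close> the intermediate condition encodes
    primitivity of alpha theta; its coprimality part also makes the index equal to the norm.\<close>
  have "(\<exists>M. similar_sublattice M \<and> clean M \<and> sublattice_index M = c) \<longleftrightarrow>
      (\<exists>a b. coprime a b \<and> \<not> 3 dvd hexnorm a b \<and> hexnorm a b = int c)"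
    (is "?L \<longleftrightarrow> ?R")
  proof
    assume ?L
    then obtain a b where ab: "a \<noteq> 0 \<or> b \<noteq> 0" "clean ((*) (hex a b) ` hex_lattice)"
      "sublattice_index ((*) (hex a b) ` hex_lattice) = c"
      by (metis similar_sublatticeE)
    then have cop: "coprime a b" "\<not> 3 dvd hexnorm a b"
      by (simp_all add: clean_mult_hex_iff coprime_hexnorm_iff)
    moreover have "hexnorm a b = int c"
      using ab(3) hexnorm_nonneg[of a b] by (simp add: sublattice_index_mult_hex[OF cop(1)])
    ultimately show ?R by blast
  next
    assume ?R
    then obtain a b where ab: "coprime a b" "\<not> 3 dvd hexnorm a b" "hexnorm a b = int c"
      by blast
    then have ne: "a \<noteq> 0 \<or> b \<noteq> 0" by auto
    have "clean ((*) (hex a b) ` hex_lattice)"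
      using ab by (simp add: clean_mult_hex_iff[OF ne] coprime_hexnorm_iff)
    moreover have "sublattice_index ((*) (hex a b) ` hex_lattice) = c"
      by (simp add: sublattice_index_mult_hex ab)
    ultimately show ?L using similar_sublattice_mult_hex[OF ne] by blast
  qed
  also have "\<dots> \<longleftrightarrow>
      (\<exists>P :: nat multiset. (\<forall>p\<in>#P. prime p \<and> [p = 1] (mod 3)) \<and> c = prod_mset P)"
    using c by (rule ex_coprime_hexnorm_iff)
  finally show "(\<exists>M. similar_sublattice M \<and> clean M \<and> sublattice_index M = c) \<longleftrightarrow>
      (\<exists>P :: nat multiset. (\<forall>p\<in>#P. prime p \<and> [p = 1] (mod 3)) \<and> c = prod_mset P)" .
qed

end
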